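(* Let $s_0,y_0\in\mathcal{Y}$, let $\kappa=L/\mu$, and let $\mathcal{L}_k=\phi(y_k)-\phi(y_* )+\frac{\mu}{2}\|s_k-y_*\|^2$ for $k\ge0$. Put $$R_1=\Bigl(\frac{2\mathcal{L}_0}{\mu}\Bigr)^{1/2},\qquad R_2=\max\{2R_1,(1+\tau\kappa)R_1\},\qquad \mathcal{B}_R=\{y:\|y-y_*\|\le R\}.$$ Assume that $$s_0\in\mathcal{B}_{R_1}\quad\text{and}\quad \{y:\phi(y)\le\phi(y_0)\}\subset\mathcal{B}_{R_1}\subset\mathcal{B}_{R_2}\subset\mathcal{Y},$$ and that the step-size satisfies $0<\tau\le\kappa^{-1/2}$. Then the iterates $(\overline{y}_k,s_{k+1},y_{k+1})$, $k\ge0$, generated by the LONAG scheme satisfy: (a) $\overline{y}_k\in\mathcal{B}_{R_1}$ and $y_{k+1}\in\mathcal{B}_{R_1}$; (b) $\phi(y_{k+1})\le\phi(\overline{y}_k)-\frac{1}{2L}\|\nabla\phi(\overline{y}_k)\|^2$; (c) $\mathcal{L}_{k+1}\le(1-\tau)\mathcal{L}_k$; (d) $s_{k+1}\in\mathcal{B}_{R_1}$.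
   Context: Work in $\mathbb{R}^m$ with an inner product $\langle\cdot,\cdot\rangle$ (e.g. $\langle x,y\rangle_P=x^{\mathsf T}Py$ with $P$ symmetric positive definite) and associated norm $\|\cdot\|$; $\nabla\phi$ is the gradient with respect to this inner product. Let $\phi:\mathbb{R}^m\to\mathbb{R}$ be smooth and let $\mathcal{Y}\subset\mathbb{R}^m$ be a convex set on which $\phi$ is strongly convex with constants $0<\mu\le L$, i.e. for all $y_1,y_2\in\mathcal{Y}$, $$\frac{\mu}{2}\|y_1-y_2\|^2\le\phi(y_1)-\phi(y_2)-\langle\nabla\phi(y_2),y_1-y_2\rangle\le\frac{L}{2}\|y_1-y_2\|^2 .$$ Let $y_*$ be the unique minimizer of $\phi$ over $\mathcal{Y}$. LONAG scheme: given $(s_0,y_0)$ and a step-size $\tau>0$, for $k=0,1,2,\dots$ define $\overline{y}_k,s_{k+1},y_{k+1}$ by $$\frac{\overline{y}_k-y_k}{\tau}=s_k-\overline{y}_k,\qquad \frac{s_{k+1}-s_k}{\tau}=(\overline{y}_k-s_k)-\frac1\mu\nabla\phi(\overline{y}_k),\qquad y_{k+1}\in\operatorname*{arg\,min}_{y\in\mathrm{span}\{y_k,\overline{y}_k,\nabla\phi(\overline{y}_k)\}}\phi(y).$$ *)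

theory Defs
  imports "HOL-Analysis.Analysis"
begin

text \<open>The inner product on \<open>\<real>\<^sup>m\<close> is arbitrary, so it is an explicit parameter \<open>ip\<close>, and the norm,
  the balls and the gradient are all taken with respect to \<open>ip\<close> rather than with respect to the
  type-class inner product.\<close>

definition inner_product :: "('a::real_vector \<Rightarrow> 'a \<Rightarrow> real) \<Rightarrow> bool" where
  "inner_product ip \<longleftrightarrow>
     bilinear ip \<and> (\<forall>x y. ip x y = ip y x) \<and> (\<forall>x. x \<noteq> 0 \<longrightarrow> 0 < ip x x)"

definition ip_norm :: "('a::real_vector \<Rightarrow> 'a \<Rightarrow> real) \<Rightarrow> 'a \<Rightarrow> real" where
  "ip_norm ip x = sqrt (ip x x)"

definition ip_cball :: "('a::real_vector \<Rightarrow> 'a \<Rightarrow> real) \<Rightarrow> 'a \<Rightarrow> real \<Rightarrow> 'a set" where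
  "ip_cball ip c R = {y. ip_norm ip (y - c) \<le> R}"

text \<open>The Frechet derivative below is the library's, taken with respect to the standard norm; in
  finite dimension all norms are equivalent, so it is also the derivative with respect to
  \<open>ip_norm ip\<close>.  The gradient is the Riesz representative of the derivative with respect to \<open>ip\<close>;
  it exists and is unique whenever \<open>ip\<close> is an inner product and \<open>\<phi>\<close> is differentiable at \<open>x\<close>.\<close>

definition gradient ::
  "('a::euclidean_space \<Rightarrow> 'a \<Rightarrow> real) \<Rightarrow> ('a \<Rightarrow> real) \<Rightarrow> 'a \<Rightarrow> 'a" where
  "gradient ip \<phi> x = (THE g. (\<phi> has_derivative (\<lambda>h. ip g h)) (at x))"

text \<open>Smooth means continuously differentiable, as is usual in optimization.  Every function of class
  \<open>C\<^sup>\<infinity>\<close> is smooth in this sense, so results assuming it cover that reading as well.\<close>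

definition smooth :: "('a::euclidean_space \<Rightarrow> real) \<Rightarrow> bool" where
  "smooth \<phi> \<longleftrightarrow>
     (\<exists>\<phi>' :: 'a \<Rightarrow> 'a \<Rightarrow>\<^sub>L real.
        (\<forall>x. (\<phi> has_derivative blinfun_apply (\<phi>' x)) (at x)) \<and> continuous_on UNIV \<phi>')"

definition strongly_convex_on ::
  "('a::euclidean_space \<Rightarrow> 'a \<Rightarrow> real) \<Rightarrow> real \<Rightarrow> real \<Rightarrow> 'a set \<Rightarrow> ('a \<Rightarrow> real) \<Rightarrow> bool" where
  "strongly_convex_on ip \<mu> L Y \<phi> \<longleftrightarrow>
     (\<forall>y1\<in>Y. \<forall>y2\<in>Y.
        \<mu> / 2 * (ip_norm ip (y1 - y2))\<^sup>2 \<le> \<phi> y1 - \<phi> y2 - ip (gradient ip \<phi> y2) (y1 - y2) \<and>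
        \<phi> y1 - \<phi> y2 - ip (gradient ip \<phi> y2) (y1 - y2) \<le> L / 2 * (ip_norm ip (y1 - y2))\<^sup>2)"

text \<open>The line search only requires \<open>y (Suc k)\<close> to be some minimizer over the span, so the scheme is a
  relation between sequences and not a function of the initial data \<open>s 0\<close>, \<open>y 0\<close>.\<close>

definition lonag ::
  "('a::euclidean_space \<Rightarrow> 'a \<Rightarrow> real) \<Rightarrow> real \<Rightarrow> ('a \<Rightarrow> real) \<Rightarrow> real \<Rightarrow>
     (nat \<Rightarrow> 'a) \<Rightarrow> (nat \<Rightarrow> 'a) \<Rightarrow> (nat \<Rightarrow> 'a) \<Rightarrow> bool" where
  "lonag ip \<mu> \<phi> \<tau> ybar s y \<longleftrightarrow>
     (\<forall>k. (ybar k - y k) /\<^sub>R \<tau> = s k - ybar k \<and>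
          (s (Suc k) - s k) /\<^sub>R \<tau> = (ybar k - s k) - (1 / \<mu>) *\<^sub>R gradient ip \<phi> (ybar k) \<and>
          is_arg_min \<phi> (\<lambda>z. z \<in> span {y k, ybar k, gradient ip \<phi> (ybar k)}) (y (Suc k)))"

definition lyapunov ::
  "('a::real_vector \<Rightarrow> 'a \<Rightarrow> real) \<Rightarrow> real \<Rightarrow> ('a \<Rightarrow> real) \<Rightarrow> 'a \<Rightarrow>
     (nat \<Rightarrow> 'a) \<Rightarrow> (nat \<Rightarrow> 'a) \<Rightarrow> nat \<Rightarrow> real" where
  "lyapunov ip \<mu> \<phi> ystar s y k = \<phi> (y k) - \<phi> ystar + \<mu> / 2 * (ip_norm ip (s k - ystar))\<^sup>2"

end

theory Submission
  imports Defs
begin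

text \<open>The hypothesis on the sublevel set makes \<open>y\<^sub>*\<close> a global minimizer, so \<open>\<nabla>\<phi>(y\<^sub>*) = 0\<close>.  The
  induction carries the invariant \<open>s\<^sub>k \<in> B(R\<^sub>1)\<close>, \<open>\<phi>(y\<^sub>k) \<le> \<phi>(y\<^sub>0)\<close> and \<open>\<L>\<^sub>k \<le> \<L>\<^sub>0\<close>.  The point
  \<open>x = ybar k\<close> is a convex combination of \<open>y\<^sub>k\<close> and \<open>s\<^sub>k\<close>, hence lies in \<open>B(R\<^sub>1)\<close>.  A gradient step from \<open>x\<close>
  of length \<open>R\<^sub>1\<close> stays in \<open>B(2R\<^sub>1) \<subseteq> Y\<close> and cannot push \<open>\<phi>\<close> below its minimum, which forces
  \<open>\<parallel>\<nabla>\<phi>(x)\<parallel> \<le> L R\<^sub>1\<close>.  So the gradient step with step-size \<open>1/L\<close> also stays in \<open>Y\<close>, and the line search does at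
  least as well.  The decay of \<open>\<L>\<close> follows by combining the strong convexity inequalities from \<open>x\<close> towards
  \<open>y\<^sub>*\<close> and \<open>y\<^sub>k\<close> with weights \<open>\<tau>\<close> and \<open>1 - \<tau>\<close>.\<close>

locale ip_space =
  fixes ip :: "'a::euclidean_space \<Rightarrow> 'a \<Rightarrow> real"
  assumes inner_product: "inner_product ip"
begin

lemma bilinear: "bilinear ip"
  using inner_product by (simp add: inner_product_def)

lemmas ip_simps =
  bilinear_ladd[OF bilinear] bilinear_radd[OF bilinear]
  bilinear_lsub[OF bilinear] bilinear_rsub[OF bilinear]
  bilinear_lmul[OF bilinear] bilinear_rmul[OF bilinear]
  bilinear_lneg[OF bilinear] bilinear_rneg[OF bilinear]
  bilinear_lzero[OF bilinear] bilinear_rzero[OF bilinear]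

lemma ip_commute: "ip x y = ip y x"
  using inner_product by (simp add: inner_product_def)

lemma ip_pos: "x \<noteq> 0 \<Longrightarrow> 0 < ip x x"
  using inner_product by (simp add: inner_product_def)

lemma ip_nonneg: "0 \<le> ip x x"
  using ip_pos[of x] by (cases "x = 0") (simp_all add: ip_simps)

lemma ip_norm_squared: "(ip_norm ip x)\<^sup>2 = ip x x"
  by (simp add: ip_norm_def ip_nonneg)

lemma mem_ip_cball_iff: "0 \<le> R \<Longrightarrow> z \<in> ip_cball ip c R \<longleftrightarrow> ip (z - c) (z - c) \<le> R\<^sup>2"
  by (simp add: ip_cball_def ip_norm_def real_sqrt_le_iff' ip_nonneg)

text \<open>The gap between the two sides is exactly
  \<open>t * (1 - t) * ip (a - b) (a - b)\<close>.\<close>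

lemma ip_square_convex:
  assumes "0 \<le> t" "t \<le> 1"
  shows "ip ((1 - t) *\<^sub>R a + t *\<^sub>R b) ((1 - t) *\<^sub>R a + t *\<^sub>R b) \<le> (1 - t) * ip a a + t * ip b b"
proof -
  have "(1 - t) * ip a a + t * ip b b - ip ((1 - t) *\<^sub>R a + t *\<^sub>R b) ((1 - t) *\<^sub>R a + t *\<^sub>R b)
      = t * (1 - t) * ip (a - b) (a - b)"
    by (simp add: ip_simps ip_commute[of b a] algebra_simps power2_eq_square)
  moreover have "0 \<le> t * (1 - t) * ip (a - b) (a - b)"
    using assms ip_nonneg by simp
  ultimately show ?thesis by linarith
qed

lemma convex_ip_cball:
  assumes "0 \<le> R"
  shows "convex (ip_cball ip c R)"
proof (rule convexI)
  fix x y and u v :: real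
  assume xy: "x \<in> ip_cball ip c R" "y \<in> ip_cball ip c R" and uv: "0 \<le> u" "0 \<le> v" "u + v = 1"
  have u: "u = 1 - v" using uv by simp
  have "u *\<^sub>R x + v *\<^sub>R y - c = (1 - v) *\<^sub>R (x - c) + v *\<^sub>R (y - c)"
    by (simp add: u algebra_simps)
  also have "ip \<dots> \<dots> \<le> (1 - v) * ip (x - c) (x - c) + v * ip (y - c) (y - c)"
    using uv by (intro ip_square_convex) auto
  also have "\<dots> \<le> (1 - v) * R\<^sup>2 + v * R\<^sup>2"
    using xy uv assms by (intro add_mono mult_left_mono) (auto simp: mem_ip_cball_iff)
  finally show "u *\<^sub>R x + v *\<^sub>R y \<in> ip_cball ip c R"
    using assms by (simp add: mem_ip_cball_iff algebra_simps)
qed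

text \<open>This is the triangle inequality in squared form: \<open>x + h - c\<close> is twice the
  midpoint of \<open>x - c\<close> and \<open>h\<close>, so convexity of the square
  suffices.\<close>

lemma ip_cball_add:
  assumes "0 \<le> R" "x \<in> ip_cball ip c R" "ip h h \<le> R\<^sup>2"
  shows "x + h \<in> ip_cball ip c (2 * R)"
proof -
  have "ip (x + h - c) (x + h - c) =
      4 * ip ((1 - 1/2) *\<^sub>R (x - c) + (1/2) *\<^sub>R h) ((1 - 1/2) *\<^sub>R (x - c) + (1/2) *\<^sub>R h)"
    by (simp add: ip_simps algebra_simps)
  also have "\<dots> \<le> 4 * ((1 - 1/2) * ip (x - c) (x - c) + 1/2 * ip h h)"
    by (intro mult_left_mono ip_square_convex) auto
  also have "\<dots> \<le> (2 * R)\<^sup>2"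
    using assms by (simp add: mem_ip_cball_iff power_mult_distrib)
  finally show ?thesis
    using assms(1) by (simp add: mem_ip_cball_iff)
qed

text \<open>Uniqueness of the derivative, together with definiteness of \<open>ip\<close>, leaves
  only one candidate for the \<open>THE\<close>.\<close>

lemma gradient_eqI:
  assumes "(\<phi> has_derivative ip g) (at x)"
  shows "gradient ip \<phi> x = g"
  unfolding gradient_def
proof (rule the_equality)
  fix g' assume "(\<phi> has_derivative ip g') (at x)"
  then have "ip g' = ip g"
    using assms by (rule has_derivative_unique)
  then have "ip (g' - g) (g' - g) = 0" by (simp add: ip_simps)
  then show "g' = g" using ip_pos[of "g' - g"] by fastforce
qed (use assms in simp)

lemma gradient_eq_0_if_minimum:
  assumes "\<phi> differentiable (at x)" "\<And>z. \<phi> x \<le> \<phi> z"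
  shows "gradient ip \<phi> x = 0"
proof -
  obtain D where D: "(\<phi> has_derivative D) (at x)"
    using assms(1) by (auto simp: differentiable_def)
  have "D = (\<lambda>h. 0)"
    using differential_zero_maxmin[of x UNIV \<phi> D] D assms(2) by auto
  moreover have "ip 0 = (\<lambda>h. 0)" by (simp add: ip_simps fun_eq_iff)
  ultimately show ?thesis using D by (intro gradient_eqI) simp
qed

text \<open>If the norm \<open>n\<close> of \<open>g\<close> exceeded \<open>L * R\<close>, the step
  of length \<open>R\<close> along \<open>- g\<close> would lower \<open>\<phi>\<close> by at least
  \<open>R * n - L / 2 * R\<^sup>2\<close>. This is more than \<open>L / 2 * R\<^sup>2\<close>, so
  the value would drop below \<open>m\<close>.\<close>

lemma ip_gradient_le:
  assumes upper: "\<And>h. ip h h \<le> R\<^sup>2 \<Longrightarrow> \<phi> (x + h) \<le> \<phi> x + ip g h + L / 2 * ip h h"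
    and lower: "\<And>z. m \<le> \<phi> z"
    and gap: "\<phi> x - m \<le> L / 2 * R\<^sup>2"
    and "0 < R" "0 < L"
  shows "ip g g \<le> (L * R)\<^sup>2"
proof (rule ccontr)
  define n where "n = ip_norm ip g"
  have gg: "ip g g = n\<^sup>2" by (simp add: n_def ip_norm_squared)
  assume "\<not> ip g g \<le> (L * R)\<^sup>2"
  moreover have "0 \<le> n" by (simp add: n_def ip_norm_def ip_nonneg)
  ultimately have n: "L * R < n"
    unfolding gg by (meson not_le power_mono)
  then have "0 < n" using assms(4,5) by (smt (verit) mult_pos_pos)
  define h where "h = - (R / n) *\<^sub>R g"
  have hh: "ip h h = R\<^sup>2" and gh: "ip g h = - (R * n)"
    using \<open>0 < n\<close> by (simp_all add: h_def ip_simps gg power2_eq_square)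
  have "m \<le> \<phi> x - R * n + L / 2 * R\<^sup>2"
    using upper[of h] lower[of "x + h"] hh gh by simp
  then have "R * n \<le> R * (L * R)"
    using gap by (simp add: power2_eq_square algebra_simps)
  then show False using n \<open>0 < R\<close> by simp
qed

text \<open>Expanding the square of \<open>s' - c\<close> leaves three terms. The one in
  \<open>ip g g\<close> is paid for by \<open>descent\<close>, the one in \<open>ip g w\<close> by
  \<open>min\<close> and \<open>cur\<close>, and the square of \<open>x - c\<close> hidden in
  \<open>ip w w\<close> by the quadratic term of \<open>min\<close>.\<close>

lemma lyapunov_decrease:
  assumes xbar: "x - y = \<tau> *\<^sub>R (s - x)"
    and s': "s' - s = \<tau> *\<^sub>R ((x - s) - (1 / \<mu>) *\<^sub>R g)"
    and descent: "\<phi> y' \<le> \<phi> x - 1 / (2 * L) * ip g g"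
    and min: "\<phi> x + ip g (c - x) + \<mu> / 2 * ip (c - x) (c - x) \<le> \<phi> c"
    and cur: "\<phi> x + ip g (y - x) \<le> \<phi> y"
    and \<tau>: "0 < \<tau>" "\<tau> \<le> 1" "\<tau>\<^sup>2 \<le> \<mu> / L" and "0 < \<mu>" "0 < L"
  shows "\<phi> y' - \<phi> c + \<mu> / 2 * ip (s' - c) (s' - c)
    \<le> (1 - \<tau>) * (\<phi> y - \<phi> c + \<mu> / 2 * ip (s - c) (s - c))"
proof -
  define w where "w = (1 - \<tau>) *\<^sub>R (s - c) + \<tau> *\<^sub>R (x - c)"
  have "s' - c = w - (\<tau> / \<mu>) *\<^sub>R g"
    using s' by (simp add: w_def algebra_simps)
  then have "ip (s' - c) (s' - c) = ip w w - 2 * (\<tau> / \<mu>) * ip g w + (\<tau> / \<mu>)\<^sup>2 * ip g g"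
    by (simp only: ip_simps ip_commute[of w g]) (simp add: algebra_simps power2_eq_square)
  then have "\<mu> / 2 * ip (s' - c) (s' - c) = \<mu> / 2 * ip w w - \<tau> * ip g w + \<tau>\<^sup>2 / (2 * \<mu>) * ip g g"
    using \<open>0 < \<mu>\<close> by (simp add: field_simps power2_eq_square)
  moreover have "\<mu> / 2 * ip w w
      \<le> \<mu> / 2 * ((1 - \<tau>) * ip (s - c) (s - c) + \<tau> * ip (x - c) (x - c))"
    unfolding w_def using \<tau> \<open>0 < \<mu>\<close> by (intro mult_left_mono ip_square_convex) auto
  moreover have "\<tau>\<^sup>2 / (2 * \<mu>) * ip g g \<le> 1 / (2 * L) * ip g g"
    using \<tau> \<open>0 < \<mu>\<close> \<open>0 < L\<close> by (intro mult_right_mono ip_nonneg) (simp add: field_simps)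
  \<comment> \<open>By \<open>xbar\<close>, \<open>\<tau> *\<^sub>R (s - x)\<close> is
    \<open>x - y\<close>, so the cross term is expressed in the directions of \<open>cur\<close> and
    \<open>min\<close>.\<close>
  moreover have "\<tau> * ip g w = (1 - \<tau>) * ip g (x - y) + \<tau> * ip g (x - c)"
    unfolding xbar by (simp add: w_def ip_simps algebra_simps)
  moreover have "\<tau> * (\<phi> x + ip g (c - x) + \<mu> / 2 * ip (c - x) (c - x)) \<le> \<tau> * \<phi> c"
    using min \<tau> by (intro mult_left_mono) auto
  moreover have "(1 - \<tau>) * (\<phi> x + ip g (y - x)) \<le> (1 - \<tau>) * \<phi> y"
    using cur \<tau> by (intro mult_left_mono) auto
  moreover have "ip (c - x) (c - x) = ip (x - c) (x - c)" "ip g (c - x) = - ip g (x - c)"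
      "ip g (y - x) = - ip g (x - y)"
    by (simp_all add: ip_simps)
  ultimately show ?thesis
    using descent by (simp add: algebra_simps diff_divide_distrib)
qed

end

theorem theorem3p2:
  fixes ip :: "real ^ 'm \<Rightarrow> real ^ 'm \<Rightarrow> real"
    and \<phi> :: "real ^ 'm \<Rightarrow> real"
    and Y :: "(real ^ 'm) set"
    and \<mu> L \<tau> \<kappa> R1 R2 :: real
    and ystar :: "real ^ 'm"
    and ybar s y :: "nat \<Rightarrow> real ^ 'm"
  assumes "inner_product ip"
    and "smooth \<phi>"
    and "convex Y"
    and "0 < \<mu>" and "\<mu> \<le> L"
    and "strongly_convex_on ip \<mu> L Y \<phi>"
    and "is_arg_min \<phi> (\<lambda>z. z \<in> Y) ystar"
    and "s 0 \<in> Y" and "y 0 \<in> Y"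
    and "\<kappa> = L / \<mu>"
    and "R1 = sqrt (2 * lyapunov ip \<mu> \<phi> ystar s y 0 / \<mu>)"
    and "R2 = max (2 * R1) ((1 + \<tau> * \<kappa>) * R1)"
    and "s 0 \<in> ip_cball ip ystar R1"
    and "{z. \<phi> z \<le> \<phi> (y 0)} \<subseteq> ip_cball ip ystar R1"
    and "ip_cball ip ystar R1 \<subseteq> ip_cball ip ystar R2"
    and "ip_cball ip ystar R2 \<subseteq> Y"
    and "0 < \<tau>" and "\<tau> \<le> \<kappa> powr (- 1 / 2)"
    and "lonag ip \<mu> \<phi> \<tau> ybar s y"
  shows "\<forall>k.
      (ybar k \<in> ip_cball ip ystar R1 \<and> y (Suc k) \<in> ip_cball ip ystar R1) \<and>
      \<phi> (y (Suc k)) \<le> \<phi> (ybar k) - 1 / (2 * L) * (ip_norm ip (gradient ip \<phi> (ybar k)))\<^sup>2 \<and>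
      lyapunov ip \<mu> \<phi> ystar s y (Suc k) \<le> (1 - \<tau>) * lyapunov ip \<mu> \<phi> ystar s y k \<and>
      s (Suc k) \<in> ip_cball ip ystar R1"
proof -
  interpret ip_space ip by unfold_locales fact
  note \<mu> = \<open>0 < \<mu>\<close> and \<tau> = \<open>0 < \<tau>\<close> and \<kappa> = \<open>\<kappa> = L / \<mu>\<close>
    and R1 = \<open>R1 = sqrt (2 * lyapunov ip \<mu> \<phi> ystar s y 0 / \<mu>)\<close>
    and sublevel = \<open>{z. \<phi> z \<le> \<phi> (y 0)} \<subseteq> ip_cball ip ystar R1\<close>
  have L: "0 < L" using \<mu> \<open>\<mu> \<le> L\<close> by simp
  let ?G = "\<lambda>x. gradient ip \<phi> x"
  let ?V = "\<lambda>k. lyapunov ip \<mu> \<phi> ystar s y k"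
  have V: "?V k = \<phi> (y k) - \<phi> ystar + \<mu> / 2 * ip (s k - ystar) (s k - ystar)" for k
    by (simp add: lyapunov_def ip_norm_squared)
  have ystar: "ystar \<in> Y" and min_Y: "\<And>z. z \<in> Y \<Longrightarrow> \<phi> ystar \<le> \<phi> z"
    using \<open>is_arg_min \<phi> (\<lambda>z. z \<in> Y) ystar\<close> by (auto simp: is_arg_min_linorder)
  have B1: "ip_cball ip ystar R1 \<subseteq> Y"
    using \<open>ip_cball ip ystar R1 \<subseteq> ip_cball ip ystar R2\<close> \<open>ip_cball ip ystar R2 \<subseteq> Y\<close> by blast
  \<comment> \<open>The sublevel set of \<open>y 0\<close> lies in \<open>Y\<close>; outside it
    \<open>\<phi>\<close> exceeds \<open>\<phi> (y 0)\<close>, which is at least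
    \<open>\<phi> ystar\<close>.\<close>
  have min: "\<phi> ystar \<le> \<phi> z" for z
  proof (cases "\<phi> z \<le> \<phi> (y 0)")
    case True
    then show ?thesis using sublevel B1 min_Y by blast
  next
    case False
    then show ?thesis using min_Y[OF \<open>y 0 \<in> Y\<close>] by simp
  qed
  have G0: "?G ystar = 0"
    using \<open>smooth \<phi>\<close> min by (intro gradient_eq_0_if_minimum) (auto simp: smooth_def differentiable_def)
  have V0: "0 \<le> ?V 0"
    using min[of "y 0"] \<mu> ip_nonneg[of "s 0 - ystar"] by (simp add: V)
  have R1_nonneg: "0 \<le> R1" and R1_sq: "R1\<^sup>2 = 2 * ?V 0 / \<mu>"
    using V0 \<mu> by (simp_all add: R1)
  \<comment> \<open>\<open>2 * R1\<close> is one of the two entries of the maximum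
    \<open>R2\<close>.\<close>
  have B2: "ip_cball ip ystar (2 * R1) \<subseteq> Y"
    using \<open>ip_cball ip ystar R2 \<subseteq> Y\<close> \<open>R2 = _\<close> by (fastforce simp: ip_cball_def)
  have lower: "\<phi> b + ip (?G b) (a - b) + \<mu> / 2 * ip (a - b) (a - b) \<le> \<phi> a"
    and upper: "\<phi> a \<le> \<phi> b + ip (?G b) (a - b) + L / 2 * ip (a - b) (a - b)"
    if "a \<in> Y" "b \<in> Y" for a b
    using \<open>strongly_convex_on ip \<mu> L Y \<phi>\<close> that
    unfolding strongly_convex_on_def ip_norm_squared by (smt (verit))+
  have \<kappa>1: "1 \<le> \<kappa>" using \<mu> \<open>\<mu> \<le> L\<close> by (simp add: \<kappa>)
  have "\<tau> * \<tau> \<le> \<kappa> powr (- 1 / 2) * \<kappa> powr (- 1 / 2)"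
    using \<tau> \<open>\<tau> \<le> \<kappa> powr (- 1 / 2)\<close> by (intro mult_mono) auto
  also have "\<dots> = 1 / \<kappa>"
    using \<kappa>1 by (simp flip: powr_add add: powr_minus_divide)
  finally have \<tau>_sq: "\<tau>\<^sup>2 \<le> \<mu> / L"
    using \<mu> L by (simp add: \<kappa> power2_eq_square)
  \<comment> \<open>This makes \<open>1 - \<tau>\<close> a valid convex weight in the decay
    estimate.\<close>
  also have "\<dots> \<le> 1" using L \<open>\<mu> \<le> L\<close> by simp
  finally have \<tau>1: "\<tau> \<le> 1" using abs_square_le_1[of \<tau>] by simp
  have grad_bound: "ip (?G x) (?G x) \<le> (L * R1)\<^sup>2" if x: "x \<in> ip_cball ip ystar R1" for x
  \<comment> \<open>A ball of radius 0 contains only \<open>ystar\<close>, where the gradient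
    vanishes.\<close>
  proof (cases "R1 = 0")
    case True
    then have "ip (x - ystar) (x - ystar) \<le> 0" using x by (simp add: mem_ip_cball_iff)
    then have "x = ystar" using ip_pos[of "x - ystar"] by fastforce
    then show ?thesis by (simp add: G0 ip_simps)
  next
    case False
    show ?thesis
    proof (rule ip_gradient_le)
      show "\<phi> (x + h) \<le> \<phi> x + ip (?G x) h + L / 2 * ip h h" if "ip h h \<le> R1\<^sup>2" for h
        using upper[of "x + h" x] ip_cball_add[OF R1_nonneg x that] x B1 B2 by auto
      \<comment> \<open>The upper quadratic bound based at \<open>ystar\<close> has no linear term,
        by \<open>G0\<close>.\<close>
      have "\<phi> x - \<phi> ystar \<le> L / 2 * ip (x - ystar) (x - ystar)"
        using upper[of x ystar] x B1 ystar by (auto simp: G0 ip_simps)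
      also have "\<dots> \<le> L / 2 * R1\<^sup>2"
        using x L R1_nonneg by (intro mult_left_mono) (auto simp: mem_ip_cball_iff)
      finally show "\<phi> x - \<phi> ystar \<le> L / 2 * R1\<^sup>2" .
    qed (use False R1_nonneg L min in auto)
  qed
  \<comment> \<open>The last conjuncts restore the invariant at \<open>Suc k\<close>, so that the
    induction closes.\<close>
  have step:
    "ybar k \<in> ip_cball ip ystar R1 \<and> y (Suc k) \<in> ip_cball ip ystar R1 \<and>
     \<phi> (y (Suc k)) \<le> \<phi> (ybar k) - 1 / (2 * L) * ip (?G (ybar k)) (?G (ybar k)) \<and>
     ?V (Suc k) \<le> (1 - \<tau>) * ?V k \<and> s (Suc k) \<in> ip_cball ip ystar R1 \<and>
     \<phi> (y (Suc k)) \<le> \<phi> (y 0) \<and> ?V (Suc k) \<le> ?V 0"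
    if sk: "s k \<in> ip_cball ip ystar R1" and yk: "\<phi> (y k) \<le> \<phi> (y 0)" and Vk: "?V k \<le> ?V 0" for k
  proof -
    define x g where "x = ybar k" and "g = ?G x"
    have scheme: "(x - y k) /\<^sub>R \<tau> = s k - x"
      "(s (Suc k) - s k) /\<^sub>R \<tau> = (x - s k) - (1 / \<mu>) *\<^sub>R g"
      and am: "is_arg_min \<phi> (\<lambda>z. z \<in> span {y k, x, g}) (y (Suc k))"
      using \<open>lonag ip \<mu> \<phi> \<tau> ybar s y\<close> by (auto simp: lonag_def x_def g_def)
    have x_eq: "x - y k = \<tau> *\<^sub>R (s k - x)"
      and s_eq: "s (Suc k) - s k = \<tau> *\<^sub>R ((x - s k) - (1 / \<mu>) *\<^sub>R g)"
      using \<tau> by (simp_all flip: scheme)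
    have search: "\<phi> (y (Suc k)) \<le> \<phi> z" if "z \<in> span {y k, x, g}" for z
      using am that by (auto simp: is_arg_min_linorder)
    have "y k \<in> ip_cball ip ystar R1" using yk sublevel by auto
    moreover have "x = (1 / (1 + \<tau>)) *\<^sub>R y k + (\<tau> / (1 + \<tau>)) *\<^sub>R s k"
    proof -
      have "(1 + \<tau>) *\<^sub>R x = y k + \<tau> *\<^sub>R s k" using x_eq by (simp add: algebra_simps)
      then have "(1 / (1 + \<tau>)) *\<^sub>R (1 + \<tau>) *\<^sub>R x = (1 / (1 + \<tau>)) *\<^sub>R (y k + \<tau> *\<^sub>R s k)" by simp
      then show ?thesis using \<tau> by (simp add: scaleR_add_right)
    qed
    moreover have "1 / (1 + \<tau>) + \<tau> / (1 + \<tau>) = 1" using \<tau> by (simp add: field_simps)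
    ultimately have x: "x \<in> ip_cball ip ystar R1"
      using convex_ip_cball[OF R1_nonneg] sk \<tau> by (simp add: convexD)
    \<comment> \<open>The span contains \<open>y k\<close>, so the line search is monotone and never
      leaves the sublevel set of \<open>y 0\<close>.\<close>
    have "\<phi> (y (Suc k)) \<le> \<phi> (y k)" by (intro search span_base) simp
    then have y': "\<phi> (y (Suc k)) \<le> \<phi> (y 0)" using yk by simp
    \<comment> \<open>Dividing the gradient bound by \<open>L\<^sup>2\<close> shows that this step
      has length at most \<open>R1\<close>. Its end point then lies in \<open>Y\<close>, where the
      upper quadratic bound holds.\<close>
    have "ip (- (1 / L) *\<^sub>R g) (- (1 / L) *\<^sub>R g) \<le> R1\<^sup>2"
      using grad_bound[OF x] L by (simp add: g_def ip_simps field_simps power2_eq_square)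
    then have "x + - (1 / L) *\<^sub>R g \<in> Y"
      using ip_cball_add[OF R1_nonneg x] B2 by blast
    then have "\<phi> (x + - (1 / L) *\<^sub>R g) \<le> \<phi> x - 1 / (2 * L) * ip g g"
      using upper[of "x + - (1 / L) *\<^sub>R g" x] x B1 L
      by (auto simp: ip_simps field_simps simp flip: g_def)
    moreover have "x + - (1 / L) *\<^sub>R g \<in> span {y k, x, g}"
      by (intro span_add span_scale span_base) auto
    ultimately have descent: "\<phi> (y (Suc k)) \<le> \<phi> x - 1 / (2 * L) * ip g g"
      using search by fastforce
    have yY: "y k \<in> Y" and xY: "x \<in> Y" using \<open>y k \<in> ip_cball ip ystar R1\<close> x B1 by auto
    have "\<phi> x + ip g (y k - x) \<le> \<phi> (y k)"
      using lower[OF yY xY] mult_nonneg_nonneg[OF _ ip_nonneg, of "\<mu> / 2" "y k - x"] \<mu>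
      by (simp add: g_def)
    then have dec: "?V (Suc k) \<le> (1 - \<tau>) * ?V k"
      unfolding V using lower[OF ystar xY] \<tau> \<tau>1 \<tau>_sq \<mu> L
      by (intro lyapunov_decrease[OF x_eq s_eq descent]) (auto simp: g_def)
    have Vk_nonneg: "0 \<le> ?V k"
      using min[of "y k"] \<mu> ip_nonneg[of "s k - ystar"] by (simp add: V)
    then have V': "?V (Suc k) \<le> ?V 0"
      using dec Vk mult_nonneg_nonneg[OF less_imp_le[OF \<tau>] Vk_nonneg] by (simp add: algebra_simps)
    \<comment> \<open>The function gap is nonnegative, so the Lyapunov value controls the distance
      term alone; \<open>R1\<close> is the radius at which that term equals the initial
      value.\<close>
    then have "\<mu> / 2 * ip (s (Suc k) - ystar) (s (Suc k) - ystar) \<le> ?V 0"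
      using min[of "y (Suc k)"] unfolding V[of "Suc k"] by linarith
    then have "ip (s (Suc k) - ystar) (s (Suc k) - ystar) \<le> R1\<^sup>2"
      using \<mu> by (simp add: R1_sq field_simps)
    then have "s (Suc k) \<in> ip_cball ip ystar R1"
      using R1_nonneg by (simp add: mem_ip_cball_iff)
    moreover have "y (Suc k) \<in> ip_cball ip ystar R1" using y' sublevel by auto
    ultimately show ?thesis
      using x descent dec y' V' by (simp add: x_def g_def)
  qed
  have inv: "s k \<in> ip_cball ip ystar R1 \<and> \<phi> (y k) \<le> \<phi> (y 0) \<and> ?V k \<le> ?V 0" for k
    by (induction k) (use \<open>s 0 \<in> ip_cball ip ystar R1\<close> step in auto)
  show ?thesis
    using step inv by (simp add: ip_norm_squared)
qed

end
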